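(* Let $(L,R(\lambda))$ be an object of the category $\mathcal{D}_1$ defined in the context. Then the dynamical Yang-Baxter map $R(\lambda)$ has at least one vertex-IRF correspondence; that is, there exist a left quasigroup $L_2$, a ternary system $M=(M,\mu)$ satisfying, for all $a,b,c,d\in M$, $$\mu(a,\mu(a,b,c),\mu(\mu(a,b,c),c,d))=\mu(a,b,\mu(b,c,d)),$$ $$\mu(\mu(a,b,c),c,d)=\mu(\mu(a,b,\mu(b,c,d)),\mu(b,c,d),d),$$ and bijections $\pi_1:L\to M$, $\pi_2:L_2\to M$ such that $R(\lambda)=R^{(L,M,\pi_1)}(\lambda)$ for all $\lambda\in L$, the map $R^{(L_2,M,\pi_2)}(\lambda_2)=:R^{(L_2,M,\pi_2)}$ is independent of $\lambda_2\in L_2$, and $$R(\lambda)=J(\lambda)^{-1}\,R^{(L_2,M,\pi_2)\,21}\,J^{21}(\lambda)\quad(\forall\lambda\in L),$$ with $J(\lambda)$, $J^{21}(\lambda)$, $R^{(L_2,M,\pi_2)\,21}$ as defined in the context.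
   Context: A left quasigroup $(L,\cdot)$ is a nonempty set $L$ with a binary operation such that for all $u,w\in L$ there is a unique $v\in L$ with $u\cdot v=w$; this $v$ is denoted $u\backslash_L w$, and $uv$ means $u\cdot v$. A ternary system $(M,\mu)$ is a nonempty set $M$ with a map $\mu:M^3\to M$. Given a left quasigroup $L$, a ternary system $M=(M,\mu)$ and a bijection $\pi:L\to M$, for $\lambda,u,v\in L$: $$\xi^{(L,M,\pi)}_\lambda(u)(v)=\lambda\backslash_L\pi^{-1}\bigl(\mu(\pi(\lambda),\pi(\lambda u),\pi((\lambda u)v))\bigr),$$ $$\eta^{(L,M,\pi)}_\lambda(u)(v)=\bigl(\lambda\,\xi^{(L,M,\pi)}_\lambda(v)(u)\bigr)\backslash_L\bigl((\lambda v)u\bigr),$$ $$R^{(L,M,\pi)}(\lambda)(u,v)=\bigl(\eta^{(L,M,\pi)}_\lambda(v)(u),\xi^{(L,M,\pi)}_\lambda(u)(v)\bigr).$$ Let $H,X$ be nonempty sets and $\phi:H\times X\to H$. A family $R(\lambda):X\times X\to X\times X$ ($\lambda\in H$) is a dynamical Yang-Baxter map associated with $H,X,\phi$ iff for every $\lambda\in H$, on $X^3$, $$R_{23}(\lambda)R_{13}(\phi(\lambda,X^{(2)}))R_{12}(\lambda)=R_{12}(\phi(\lambda,X^{(3)}))R_{13}(\lambda)R_{23}(\phi(\lambda,X^{(1)})),$$ where $R_{ij}(\lambda)$ applies $R(\lambda)$ to the $i$-th and $j$-th components and fixes the other, and $R_{ij}(\phi(\lambda,X^{(k)}))(u_1,u_2,u_3)=R_{ij}(\phi(\lambda,u_k))(u_1,u_2,u_3)$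 with $\{i,j,k\}=\{1,2,3\}$. An object of $\mathcal{D}_1$ is a pair $(L,R(\lambda))$ where $L=(L,\cdot)$ is a left quasigroup and $R(\lambda)$ ($\lambda\in L$) is a dynamical Yang-Baxter map associated with $L,L,(\cdot)$ such that, writing $R(\lambda)(u,v)=(\eta_\lambda(v)(u),\xi_\lambda(u)(v))$, for all $\lambda,u,v\in L$: $(\lambda\,\xi_\lambda(u)(v))\,\eta_\lambda(v)(u)=(\lambda u)v$; $\ \xi_\lambda(u)\xi_{\lambda u}(v)=\xi_\lambda(\lambda\backslash_L((\lambda u)v))$; and $\xi_\lambda(\lambda\backslash_L\lambda)=\mathrm{id}_L$. For a set $X$, $P_X(u,v)=(v,u)$. For a left quasigroup $N$ and $\nu\in N$, $\tilde f^{N}_\nu:N\times N\to N\times N$ is the bijection $\tilde f^{N}_\nu(u,v)=(\nu u,(\nu u)v)$. With $L,L_2,M,\pi_1,\pi_2$ as in the claim, $$J(\lambda)=\bigl(\tilde f^{L_2}_{\pi_2^{-1}\pi_1(\lambda)}\bigr)^{-1}(\pi_2^{-1}\pi_1\times\pi_2^{-1}\pi_1)\,\tilde f^{L}_\lambda\,P_L:L\times L\to L_2\times L_2,$$ which is bijective, $J^{21}(\lambda)=P_{L_2}J(\lambda)P_L$, and $R^{(L_2,M,\pi_2)\,21}=P_{L_2}R^{(L_2,M,\pi_2)}P_{L_2}$. *)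

theory Defs
  imports Main "HOL-Library.FuncSet"
begin

text \<open>
  All structures live on an explicit carrier set; operations and maps are total HOL functions
  of which only the values on the carriers matter.
\<close>

definition left_quasigroup :: "'a set \<Rightarrow> ('a \<Rightarrow> 'a \<Rightarrow> 'a) \<Rightarrow> bool" where
  "left_quasigroup L m \<longleftrightarrow>
     L \<noteq> {} \<and> (\<forall>u\<in>L. \<forall>v\<in>L. m u v \<in> L) \<and>
     (\<forall>u\<in>L. \<forall>w\<in>L. \<exists>!v. v \<in> L \<and> m u v = w)"

text \<open>\<open>ldiv L m u w\<close> is $u\backslash_L w$.\<close>

definition ldiv :: "'a set \<Rightarrow> ('a \<Rightarrow> 'a \<Rightarrow> 'a) \<Rightarrow> 'a \<Rightarrow> 'a \<Rightarrow> 'a" where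
  "ldiv L m u w = (THE v. v \<in> L \<and> m u v = w)"

definition ternary_system :: "'b set \<Rightarrow> ('b \<Rightarrow> 'b \<Rightarrow> 'b \<Rightarrow> 'b) \<Rightarrow> bool" where
  "ternary_system M \<mu> \<longleftrightarrow> M \<noteq> {} \<and> (\<forall>a\<in>M. \<forall>b\<in>M. \<forall>c\<in>M. \<mu> a b c \<in> M)"

text \<open>
  The maps $\xi^{(L,M,\pi)}$, $\eta^{(L,M,\pi)}$, $R^{(L,M,\pi)}$. The carrier of $M$ is not an
  argument: it is the image of $L$ under the bijection $\pi$.
\<close>

definition xi_map ::
  "'a set \<Rightarrow> ('a \<Rightarrow> 'a \<Rightarrow> 'a) \<Rightarrow> ('b \<Rightarrow> 'b \<Rightarrow> 'b \<Rightarrow> 'b) \<Rightarrow> ('a \<Rightarrow> 'b) \<Rightarrow> 'a \<Rightarrow> 'a \<Rightarrow> 'a \<Rightarrow> 'a" where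
  "xi_map L m \<mu> \<pi> l u v =
     ldiv L m l (inv_into L \<pi> (\<mu> (\<pi> l) (\<pi> (m l u)) (\<pi> (m (m l u) v))))"

definition eta_map ::
  "'a set \<Rightarrow> ('a \<Rightarrow> 'a \<Rightarrow> 'a) \<Rightarrow> ('b \<Rightarrow> 'b \<Rightarrow> 'b \<Rightarrow> 'b) \<Rightarrow> ('a \<Rightarrow> 'b) \<Rightarrow> 'a \<Rightarrow> 'a \<Rightarrow> 'a \<Rightarrow> 'a" where
  "eta_map L m \<mu> \<pi> l u v =
     ldiv L m (m l (xi_map L m \<mu> \<pi> l v u)) (m (m l v) u)"

definition R_map ::
  "'a set \<Rightarrow> ('a \<Rightarrow> 'a \<Rightarrow> 'a) \<Rightarrow> ('b \<Rightarrow> 'b \<Rightarrow> 'b \<Rightarrow> 'b) \<Rightarrow> ('a \<Rightarrow> 'b) \<Rightarrow> 'a \<Rightarrow> 'a \<times> 'a \<Rightarrow> 'a \<times> 'a" where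
  "R_map L m \<mu> \<pi> l = (\<lambda>(u, v). (eta_map L m \<mu> \<pi> l v u, xi_map L m \<mu> \<pi> l u v))"

text \<open>
  \<open>legij F\<close> applies \<open>F u\<^sub>k\<close> to the components \<open>i\<close> and \<open>j\<close>, where \<open>u\<^sub>k\<close> is the remaining component.
  Thus $R_{ij}(\lambda)$ is \<open>legij (\<lambda>_. R l)\<close> and $R_{ij}(\phi(\lambda,X^{(k)}))$ is
  \<open>legij (\<lambda>x. R (\<phi> l x))\<close>.
\<close>

definition leg12 :: "('x \<Rightarrow> 'x \<times> 'x \<Rightarrow> 'x \<times> 'x) \<Rightarrow> 'x \<times> 'x \<times> 'x \<Rightarrow> 'x \<times> 'x \<times> 'x" where
  "leg12 F = (\<lambda>(u1, u2, u3). (fst (F u3 (u1, u2)), snd (F u3 (u1, u2)), u3))"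

definition leg13 :: "('x \<Rightarrow> 'x \<times> 'x \<Rightarrow> 'x \<times> 'x) \<Rightarrow> 'x \<times> 'x \<times> 'x \<Rightarrow> 'x \<times> 'x \<times> 'x" where
  "leg13 F = (\<lambda>(u1, u2, u3). (fst (F u2 (u1, u3)), u2, snd (F u2 (u1, u3))))"

definition leg23 :: "('x \<Rightarrow> 'x \<times> 'x \<Rightarrow> 'x \<times> 'x) \<Rightarrow> 'x \<times> 'x \<times> 'x \<Rightarrow> 'x \<times> 'x \<times> 'x" where
  "leg23 F = (\<lambda>(u1, u2, u3). (u1, fst (F u1 (u2, u3)), snd (F u1 (u2, u3))))"

definition dynamical_YB_map ::
  "'h set \<Rightarrow> 'x set \<Rightarrow> ('h \<Rightarrow> 'x \<Rightarrow> 'h) \<Rightarrow> ('h \<Rightarrow> 'x \<times> 'x \<Rightarrow> 'x \<times> 'x) \<Rightarrow> bool" where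
  "dynamical_YB_map H X \<phi> R \<longleftrightarrow>
     H \<noteq> {} \<and> X \<noteq> {} \<and> (\<forall>l\<in>H. \<forall>x\<in>X. \<phi> l x \<in> H) \<and>
     (\<forall>l\<in>H. R l \<in> X \<times> X \<rightarrow> X \<times> X) \<and>
     (\<forall>l\<in>H. \<forall>t \<in> X \<times> X \<times> X.
        (leg23 (\<lambda>_. R l) \<circ> leg13 (\<lambda>x. R (\<phi> l x)) \<circ> leg12 (\<lambda>_. R l)) t =
        (leg12 (\<lambda>x. R (\<phi> l x)) \<circ> leg13 (\<lambda>_. R l) \<circ> leg23 (\<lambda>x. R (\<phi> l x))) t)"

text \<open>The components of \<open>R\<close> in $R(\lambda)(u,v)=(\eta_\lambda(v)(u),\xi_\lambda(u)(v))$.\<close>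

definition eta_of :: "('h \<Rightarrow> 'x \<times> 'x \<Rightarrow> 'x \<times> 'x) \<Rightarrow> 'h \<Rightarrow> 'x \<Rightarrow> 'x \<Rightarrow> 'x" where
  "eta_of R l v u = fst (R l (u, v))"

definition xi_of :: "('h \<Rightarrow> 'x \<times> 'x \<Rightarrow> 'x \<times> 'x) \<Rightarrow> 'h \<Rightarrow> 'x \<Rightarrow> 'x \<Rightarrow> 'x" where
  "xi_of R l u v = snd (R l (u, v))"

definition D1_object ::
  "'a set \<Rightarrow> ('a \<Rightarrow> 'a \<Rightarrow> 'a) \<Rightarrow> ('a \<Rightarrow> 'a \<times> 'a \<Rightarrow> 'a \<times> 'a) \<Rightarrow> bool" where
  "D1_object L m R \<longleftrightarrow>
     left_quasigroup L m \<and> dynamical_YB_map L L m R \<and>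
     (\<forall>l\<in>L. \<forall>u\<in>L. \<forall>v\<in>L. m (m l (xi_of R l u v)) (eta_of R l v u) = m (m l u) v) \<and>
     (\<forall>l\<in>L. \<forall>u\<in>L. \<forall>v\<in>L. \<forall>w\<in>L.
        xi_of R l u (xi_of R (m l u) v w) = xi_of R l (ldiv L m l (m (m l u) v)) w) \<and>
     (\<forall>l\<in>L. \<forall>w\<in>L. xi_of R l (ldiv L m l l) w = w)"

definition ftilde :: "('a \<Rightarrow> 'a \<Rightarrow> 'a) \<Rightarrow> 'a \<Rightarrow> 'a \<times> 'a \<Rightarrow> 'a \<times> 'a" where
  "ftilde m n = (\<lambda>(u, v). (m n u, m (m n u) v))"

text \<open>The transposition $P_X$ is \<^const>\<open>prod.swap\<close>.\<close>

definition J_map ::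
  "('a \<Rightarrow> 'a \<Rightarrow> 'a) \<Rightarrow> 'c set \<Rightarrow> ('c \<Rightarrow> 'c \<Rightarrow> 'c) \<Rightarrow> ('a \<Rightarrow> 'b) \<Rightarrow> ('c \<Rightarrow> 'b) \<Rightarrow>
   'a \<Rightarrow> 'a \<times> 'a \<Rightarrow> 'c \<times> 'c" where
  "J_map m L2 m2 \<pi>1 \<pi>2 l =
     (let \<sigma> = inv_into L2 \<pi>2 \<circ> \<pi>1
      in inv_into (L2 \<times> L2) (ftilde m2 (\<sigma> l)) \<circ> map_prod \<sigma> \<sigma> \<circ> ftilde m l \<circ> prod.swap)"

definition flip21 :: "('a \<times> 'a \<Rightarrow> 'b \<times> 'b) \<Rightarrow> 'a \<times> 'a \<Rightarrow> 'b \<times> 'b" where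
  "flip21 F = prod.swap \<circ> F \<circ> prod.swap"

end

theory Submission
  imports Defs
begin

text \<open>
  The idea is to replace the edge labels \<open>u, v\<close> of a path by its vertices
  \<open>a\<close>, \<open>b = a u\<close>, \<open>c = b v\<close>. The weight-zero condition
  \<open>(\<lambda> \<xi>\<^sub>\<lambda>(u)(v)) \<eta>\<^sub>\<lambda>(v)(u) = (\<lambda> u) v\<close> says that \<open>R(a)\<close> keeps the end points of the path
  \<open>a \<rightarrow> b \<rightarrow> c\<close> and moves only its middle vertex, to a vertex that is called \<open>\<mu> a b c\<close>
  (\<open>R_path\<close>). Tracking the vertices of a path of length three through both sides of the dynamical
  Yang-Baxter equation gives exactly the two ternary axioms for \<open>\<mu>\<close>
  (\<open>midpoint_assoc\<close>, \<open>midpoint_YB\<close>). So \<open>M = L\<close> and \<open>\<pi>\<^sub>1 = id\<close>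
  will do, and it remains to find a left quasigroup structure on \<open>L\<close> for which \<open>\<mu>\<close> gives a
  constant map.

  Put \<open>\<Phi>\<^sub>a\<^sub>b = \<xi>\<^sub>a(a \ b)\<close>. The other two conditions on an object of \<open>D\<^sub>1\<close> read
  \<open>\<Phi>\<^sub>a\<^sub>b \<Phi>\<^sub>b\<^sub>c = \<Phi>\<^sub>a\<^sub>c\<close> and \<open>\<Phi>\<^sub>a\<^sub>a = id\<close>: \<open>\<Phi>\<close> is a cocycle, and hence a coboundary. Choose a base
  point \<open>q\<close>; then \<open>\<Phi>\<^sub>a\<^sub>b = \<Phi>\<^sub>a\<^sub>q \<Phi>\<^sub>q\<^sub>b\<close>, with \<open>\<Phi>\<^sub>a\<^sub>q\<close> and \<open>\<Phi>\<^sub>q\<^sub>a\<close> mutually inverse. Changing the edge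
  labels by this gauge, that is, putting \<open>a * v = a \<Phi>\<^sub>a\<^sub>q(v)\<close>, gives a left quasigroup with
  \<open>\<mu> a b c = a * (b \ c)\<close>, the division now being that of \<open>*\<close> (\<open>midpoint_gauge\<close>). In these labels
  the path \<open>a \<rightarrow> b \<rightarrow> c\<close> and the path \<open>a \<rightarrow> \<mu> a b c \<rightarrow> c\<close> share a label, namely that of \<open>b \<rightarrow> c\<close>
  and of \<open>a \<rightarrow> \<mu> a b c\<close>, and the second ternary axiom says that, for given labels of
  \<open>a \<rightarrow> b \<rightarrow> c\<close>, the remaining label does not depend on \<open>a\<close>
  (\<open>ternary_YB_imp_label_independent\<close>). This is the constancy of the map
  attached to \<open>*\<close>.

  Finally, \<open>J(\<lambda>)\<close> is just the change of labels of a path from \<open>\<cdot>\<close> to \<open>*\<close>, with the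
  order of the components reversed (\<open>J_path\<close>). As both maps move the middle vertex in the same way,
  \<open>J\<close> intertwines them.
\<close>

section \<open>Division in a left quasigroup\<close>

lemma ldiv_in:
  assumes "left_quasigroup L m" "a \<in> L" "b \<in> L"
  shows "ldiv L m a b \<in> L"
proof -
  have "\<exists>!v. v \<in> L \<and> m a v = b" using assms unfolding left_quasigroup_def by blast
  from theI'[OF this] show ?thesis unfolding ldiv_def by blast
qed

lemma mult_ldiv:
  assumes "left_quasigroup L m" "a \<in> L" "b \<in> L"
  shows "m a (ldiv L m a b) = b"
proof -
  have "\<exists>!v. v \<in> L \<and> m a v = b" using assms unfolding left_quasigroup_def by blast
  from theI'[OF this] show ?thesis unfolding ldiv_def by blast
qed

lemma ldiv_eqI:
  assumes "left_quasigroup L m" "a \<in> L" "v \<in> L" "m a v = b"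
  shows "ldiv L m a b = v"
proof -
  have "b \<in> L" using assms unfolding left_quasigroup_def by blast
  then have "\<exists>!v. v \<in> L \<and> m a v = b" using assms unfolding left_quasigroup_def by blast
  then show ?thesis using assms unfolding ldiv_def by blast
qed

lemma ldiv_mult:
  assumes "left_quasigroup L m" "a \<in> L" "v \<in> L"
  shows "ldiv L m a (m a v) = v"
  using ldiv_eqI[OF assms] by simp

lemma left_quasigroup_closed:
  assumes "left_quasigroup L m" "a \<in> L" "v \<in> L"
  shows "m a v \<in> L"
  using assms unfolding left_quasigroup_def by blast

section \<open>Labelled paths\<close>

text \<open>
  Every pair of labels is the label of exactly one path with a given starting point. It is in
  this form that statements about pairs are reduced to statements about vertices.
\<close>

lemma path_of_labels:
  assumes "left_quasigroup L m" "a \<in> L" "p \<in> L \<times> L"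
  obtains b c where "b \<in> L" "c \<in> L" "p = (ldiv L m a b, ldiv L m b c)"
proof -
  obtain u v where "p = (u, v)" "u \<in> L" "v \<in> L" using assms by blast
  then show ?thesis
    using that[of "m a u" "m (m a u) v"] assms by (simp add: ldiv_mult left_quasigroup_closed)
qed

lemma R_map_path:
  assumes "left_quasigroup L m" "a \<in> L" "b \<in> L" "c \<in> L" "\<mu> a b c \<in> L"
  shows "R_map L m \<mu> id a (ldiv L m a b, ldiv L m b c)
    = (ldiv L m (\<mu> a b c) c, ldiv L m a (\<mu> a b c))"
  using assms
  by (simp add: R_map_def eta_map_def xi_map_def mult_ldiv ldiv_in inv_into_f_f[of id, simplified])

text \<open>
  This is what the formula for \<open>J\<close> means: the swap restores the order of the edges,
  \<open>ftilde\<close> for \<open>m\<close> reads off the vertices \<open>b, c\<close> from the labels, and the inverse of \<open>ftilde\<close> for \<open>m2\<close>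
  labels the same path again.
\<close>

lemma J_path:
  assumes m: "left_quasigroup L m" and m2: "left_quasigroup L m2"
    and abc: "a \<in> L" "b \<in> L" "c \<in> L"
  shows "J_map m L m2 id id a (ldiv L m b c, ldiv L m a b) = (ldiv L m2 a b, ldiv L m2 b c)"
proof -
  have inj: "inj_on (ftilde m2 a) (L \<times> L)"
  proof (rule inj_onI)
    fix p q assume pq: "p \<in> L \<times> L" "q \<in> L \<times> L" "ftilde m2 a p = ftilde m2 a q"
    obtain b c where "b \<in> L" "c \<in> L" "p = (ldiv L m2 a b, ldiv L m2 b c)"
      using path_of_labels[OF m2 \<open>a \<in> L\<close> pq(1)] .
    moreover obtain b' c' where "b' \<in> L" "c' \<in> L" "q = (ldiv L m2 a b', ldiv L m2 b' c')"
      using path_of_labels[OF m2 \<open>a \<in> L\<close> pq(2)] .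
    ultimately show "p = q"
      using pq(3) abc by (simp add: ftilde_def mult_ldiv[OF m2])
  qed
  have "inv_into (L \<times> L) (ftilde m2 a) (b, c) = (ldiv L m2 a b, ldiv L m2 b c)"
    using abc
    by (intro inv_into_f_eq[OF inj]) (simp_all add: ftilde_def mult_ldiv[OF m2] ldiv_in[OF m2])
  moreover have "ftilde m a (ldiv L m a b, ldiv L m b c) = (b, c)"
    using abc by (simp add: ftilde_def mult_ldiv[OF m])
  moreover have "inv_into L id x = x" if "x \<in> L" for x
    using inv_into_f_f[of id L x] that by simp
  ultimately show ?thesis
    using abc by (simp add: J_map_def Let_def)
qed

lemma inj_on_J_map:
  assumes m: "left_quasigroup L m" and m2: "left_quasigroup L m2" and a: "a \<in> L"
  shows "inj_on (J_map m L m2 id id a) (L \<times> L)"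
proof (rule inj_onI)
  fix p q assume pq: "p \<in> L \<times> L" "q \<in> L \<times> L"
    and eq: "J_map m L m2 id id a p = J_map m L m2 id id a q"
  have "prod.swap p \<in> L \<times> L" "prod.swap q \<in> L \<times> L" using pq by auto
  obtain b c where p: "b \<in> L" "c \<in> L" "prod.swap p = (ldiv L m a b, ldiv L m b c)"
    using path_of_labels[OF m a \<open>prod.swap p \<in> L \<times> L\<close>] .
  obtain b' c' where q: "b' \<in> L" "c' \<in> L" "prod.swap q = (ldiv L m a b', ldiv L m b' c')"
    using path_of_labels[OF m a \<open>prod.swap q \<in> L \<times> L\<close>] .
  have p': "p = (ldiv L m b c, ldiv L m a b)" and q': "q = (ldiv L m b' c', ldiv L m a b')"
    using p(3) q(3) by (auto simp: prod_eq_iff)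
  have "(ldiv L m2 a b, ldiv L m2 b c) = (ldiv L m2 a b', ldiv L m2 b' c')"
    using eq unfolding p' q' J_path[OF m m2 a p(1,2)] J_path[OF m m2 a q(1,2)] .
  then have label1: "ldiv L m2 a b = ldiv L m2 a b'" and label2: "ldiv L m2 b c = ldiv L m2 b' c'"
    by simp_all
  have "b = b'"
    using arg_cong[OF label1, of "m2 a"] a p(1) q(1) by (simp only: mult_ldiv[OF m2])
  moreover from this have "c = c'"
    using arg_cong[OF label2, of "m2 b"] p(1,2) q(1,2) by (simp only: mult_ldiv[OF m2])
  ultimately show "p = q" unfolding p' q' by simp
qed

text \<open>
  Both maps replace the middle vertex \<open>b\<close> by the same \<open>\<mu> a b c\<close> and differ only in how they label the
  path, so relabelling carries one to the other. The flips compensate the reversed order in \<open>J\<close>.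
\<close>

lemma J_map_intertwines:
  assumes m: "left_quasigroup L m" and m2: "left_quasigroup L m2"
    and closed: "\<And>a b c. a \<in> L \<Longrightarrow> b \<in> L \<Longrightarrow> c \<in> L \<Longrightarrow> \<mu> a b c \<in> L"
    and a: "a \<in> L" and p: "p \<in> L \<times> L"
  shows "(inv_into (L \<times> L) (J_map m L m2 id id a) \<circ> flip21 (R_map L m2 \<mu> id a) \<circ>
      flip21 (J_map m L m2 id id a)) p = R_map L m \<mu> id a p"
proof -
  obtain b c where bc: "b \<in> L" "c \<in> L" "p = (ldiv L m a b, ldiv L m b c)"
    using path_of_labels[OF m a p] .
  let ?e = "\<mu> a b c"
  have e: "?e \<in> L" using closed a bc by blast
  have "flip21 (R_map L m2 \<mu> id a) (flip21 (J_map m L m2 id id a) p)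
      = (ldiv L m2 a ?e, ldiv L m2 ?e c)"
    using J_path[OF m m2 a] R_map_path[OF m2 a] bc e by (simp add: flip21_def)
  also have "\<dots> = J_map m L m2 id id a (ldiv L m ?e c, ldiv L m a ?e)"
    using J_path[OF m m2 a] bc e by simp
  finally have "flip21 (R_map L m2 \<mu> id a) (flip21 (J_map m L m2 id id a) p)
      = J_map m L m2 id id a (R_map L m \<mu> id a p)"
    using R_map_path[OF m a, of b c \<mu>] bc e by simp
  moreover have "R_map L m \<mu> id a p \<in> L \<times> L"
    using R_map_path[OF m a, of b c \<mu>] a bc e by (simp add: ldiv_in[OF m])
  ultimately show ?thesis
    by (simp add: inv_into_f_f[OF inj_on_J_map[OF m m2 a]])
qed

text \<open>
  When \<open>\<mu> a b c = a * (b \ c)\<close>, put \<open>u = a \ b\<close> and \<open>v = b \ c\<close>. The new labels of the path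
  from \<open>a\<close> are \<open>v\<close> and \<open>(a * v) \ ((a * u) * v)\<close>. The second ternary axiom, applied to the vertices
  \<open>x, y, y * u, (y * u) * v\<close>, becomes \<open>(x * u) * v = (x * v) * ((y * v) \ ((y * u) * v))\<close>, which says
  that the latter label is the same for \<open>a = x\<close> and \<open>a = y\<close>.
\<close>

lemma ternary_YB_imp_label_independent:
  assumes m: "left_quasigroup L m"
    and \<mu>: "\<And>a b c. a \<in> L \<Longrightarrow> b \<in> L \<Longrightarrow> c \<in> L \<Longrightarrow> \<mu> a b c = m a (ldiv L m b c)"
    and YB: "\<And>a b c d. a \<in> L \<Longrightarrow> b \<in> L \<Longrightarrow> c \<in> L \<Longrightarrow> d \<in> L \<Longrightarrow>
      \<mu> (\<mu> a b c) c d = \<mu> (\<mu> a b (\<mu> b c d)) (\<mu> b c d) d"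
    and x: "x \<in> L" and y: "y \<in> L" and p: "p \<in> L \<times> L"
  shows "R_map L m \<mu> id x p = R_map L m \<mu> id y p"
proof -
  note cl = left_quasigroup_closed[OF m] and dv = ldiv_in[OF m] ldiv_mult[OF m]
  obtain u v where uv: "p = (u, v)" "u \<in> L" "v \<in> L" using p by blast
  have R: "R_map L m \<mu> id z (u, v) = (ldiv L m (m z v) (m (m z u) v), v)" if "z \<in> L" for z
    using R_map_path[OF m that, of "m z u" "m (m z u) v" \<mu>] that uv
    by (simp add: \<mu> cl dv)
  have "m (m x u) v = m (m x v) (ldiv L m (m y v) (m (m y u) v))"
    using YB[OF x y, of "m y u" "m (m y u) v"] x y uv by (simp add: \<mu> cl dv)
  then have "ldiv L m (m x v) (m (m x u) v) = ldiv L m (m y v) (m (m y u) v)"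
    using x y uv by (simp add: cl dv)
  then show ?thesis using R x y uv by simp
qed

section \<open>The ternary operation of an object\<close>

definition midpoint ::
  "'a set \<Rightarrow> ('a \<Rightarrow> 'a \<Rightarrow> 'a) \<Rightarrow> ('a \<Rightarrow> 'a \<times> 'a \<Rightarrow> 'a \<times> 'a) \<Rightarrow> 'a \<Rightarrow> 'a \<Rightarrow> 'a \<Rightarrow> 'a" where
  "midpoint L m R a b c = m a (xi_of R a (ldiv L m a b) (ldiv L m b c))"

locale D1 =
  fixes L :: "'a set" and m :: "'a \<Rightarrow> 'a \<Rightarrow> 'a" and R :: "'a \<Rightarrow> 'a \<times> 'a \<Rightarrow> 'a \<times> 'a"
  assumes D1_object: "D1_object L m R"
begin

abbreviation (input) dv :: "'a \<Rightarrow> 'a \<Rightarrow> 'a" where "dv \<equiv> ldiv L m"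
abbreviation (input) \<mu> :: "'a \<Rightarrow> 'a \<Rightarrow> 'a \<Rightarrow> 'a" where "\<mu> \<equiv> midpoint L m R"

lemma quasigroup: "left_quasigroup L m"
  using D1_object unfolding D1_object_def by blast

lemma YB_map: "dynamical_YB_map L L m R"
  using D1_object unfolding D1_object_def by blast

lemmas m_closed = left_quasigroup_closed[OF quasigroup]
lemmas dv_simps = ldiv_in[OF quasigroup] mult_ldiv[OF quasigroup] ldiv_mult[OF quasigroup]

lemma R_closed:
  assumes "a \<in> L" "u \<in> L" "v \<in> L"
  shows "R a (u, v) \<in> L \<times> L"
  using YB_map assms unfolding dynamical_YB_map_def Pi_def by blast

lemma xi_closed:
  assumes "a \<in> L" "u \<in> L" "v \<in> L"
  shows "xi_of R a u v \<in> L"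
  using R_closed[OF assms] unfolding xi_of_def by (auto simp: mem_Times_iff)

lemma midpoint_closed:
  assumes "a \<in> L" "b \<in> L" "c \<in> L"
  shows "\<mu> a b c \<in> L"
  using assms by (simp add: midpoint_def m_closed xi_closed dv_simps)

text \<open>
  The second component defines the new middle vertex; the weight-zero condition then determines the
  first component as the label of the edge from there to \<open>c\<close>.
\<close>

lemma R_path:
  assumes "a \<in> L" "b \<in> L" "c \<in> L"
  shows "R a (dv a b, dv b c) = (dv (\<mu> a b c) c, dv a (\<mu> a b c))"
proof -
  let ?u = "dv a b" and ?v = "dv b c"
  have uv: "?u \<in> L" "?v \<in> L" using assms by (simp_all add: dv_simps)
  have eta: "eta_of R a ?v ?u \<in> L"
    using R_closed[OF \<open>a \<in> L\<close> uv] unfolding eta_of_def by (auto simp: mem_Times_iff)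
  have "\<forall>l\<in>L. \<forall>u\<in>L. \<forall>v\<in>L. m (m l (xi_of R l u v)) (eta_of R l v u) = m (m l u) v"
    using D1_object unfolding D1_object_def by blast
  then have "m (\<mu> a b c) (eta_of R a ?v ?u) = c"
    using assms uv by (simp add: midpoint_def dv_simps)
  then have "dv (\<mu> a b c) c = eta_of R a ?v ?u"
    using ldiv_eqI[OF quasigroup midpoint_closed[OF assms] eta] by blast
  moreover have "dv a (\<mu> a b c) = xi_of R a ?u ?v"
    using assms uv by (simp add: midpoint_def dv_simps xi_closed)
  ultimately show ?thesis by (simp add: eta_of_def xi_of_def)
qed

text \<open>
  Both sides of the dynamical Yang-Baxter equation are applied to the labels of
  \<open>a \<rightarrow> b \<rightarrow> c \<rightarrow> d\<close>. Each factor moves one vertex: the left side ends in the path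
  \<open>a \<rightarrow> \<mu> a e h \<rightarrow> h \<rightarrow> d\<close> and the right side in \<open>a \<rightarrow> g \<rightarrow> \<mu> g f d \<rightarrow> d\<close>, where
  \<open>e = \<mu> a b c\<close>, \<open>h = \<mu> e c d\<close>, \<open>f = \<mu> b c d\<close>, \<open>g = \<mu> a b f\<close>. As every factor
  also interchanges its two labels, the result lists the labels from the last edge to the first.
  Comparing the two inner vertices gives the two ternary axioms.
\<close>

lemma midpoint_ternary_axioms:
  assumes abcd: "a \<in> L" "b \<in> L" "c \<in> L" "d \<in> L"
  shows midpoint_assoc: "\<mu> a (\<mu> a b c) (\<mu> (\<mu> a b c) c d) = \<mu> a b (\<mu> b c d)"
    and midpoint_YB: "\<mu> (\<mu> a b c) c d = \<mu> (\<mu> a b (\<mu> b c d)) (\<mu> b c d) d"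
proof -
  define e where "e = \<mu> a b c"
  define h where "h = \<mu> e c d"
  define f where "f = \<mu> b c d"
  define g where "g = \<mu> a b f"
  have e: "e \<in> L" and h: "h \<in> L" and f: "f \<in> L" and g: "g \<in> L"
    using abcd by (simp_all add: e_def h_def f_def g_def midpoint_closed)
  have k: "\<mu> a e h \<in> L" and k': "\<mu> g f d \<in> L"
    using abcd e h f g by (simp_all add: midpoint_closed)
  let ?t = "(dv a b, dv b c, dv c d)"
  have "(leg23 (\<lambda>_. R a) \<circ> leg13 (\<lambda>x. R (m a x)) \<circ> leg12 (\<lambda>_. R a)) ?t
      = (dv h d, dv (\<mu> a e h) h, dv a (\<mu> a e h))"
    using abcd e h
    by (simp add: leg12_def leg13_def leg23_def R_path dv_simps flip: e_def h_def)
  moreover have "(leg12 (\<lambda>x. R (m a x)) \<circ> leg13 (\<lambda>_. R a) \<circ> leg23 (\<lambda>x. R (m a x))) ?t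
      = (dv (\<mu> g f d) d, dv g (\<mu> g f d), dv a g)"
    using abcd f g
    by (simp add: leg12_def leg13_def leg23_def R_path dv_simps flip: f_def g_def)
  moreover have "?t \<in> L \<times> L \<times> L" using abcd by (simp add: dv_simps)
  then have "(leg23 (\<lambda>_. R a) \<circ> leg13 (\<lambda>x. R (m a x)) \<circ> leg12 (\<lambda>_. R a)) ?t
      = (leg12 (\<lambda>x. R (m a x)) \<circ> leg13 (\<lambda>_. R a) \<circ> leg23 (\<lambda>x. R (m a x))) ?t"
    using YB_map \<open>a \<in> L\<close> unfolding dynamical_YB_map_def by blast
  ultimately have inner: "dv (\<mu> a e h) h = dv g (\<mu> g f d)" and first: "dv a (\<mu> a e h) = dv a g"
    by simp_all
  have "\<mu> a e h = m a (dv a (\<mu> a e h))" using abcd k by (simp add: dv_simps)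
  also have "\<dots> = g" using abcd g first by (simp add: dv_simps)
  finally have g_eq: "\<mu> a e h = g" .
  then show "\<mu> a (\<mu> a b c) (\<mu> (\<mu> a b c) c d) = \<mu> a b (\<mu> b c d)"
    by (simp add: e_def h_def f_def g_def)
  have "h = m g (dv g h)" using g h by (simp add: dv_simps)
  also have "\<dots> = \<mu> g f d" using g k' inner g_eq by (simp add: dv_simps)
  finally show "\<mu> (\<mu> a b c) c d = \<mu> (\<mu> a b (\<mu> b c d)) (\<mu> b c d) d"
    by (simp add: e_def h_def f_def g_def)
qed

section \<open>The gauge transformation\<close>

text \<open>
  The composition law for \<open>\<xi>\<close>, read with \<open>u = a \ b\<close> and \<open>v = b \ c\<close>, is the cocycle law for
  \<open>\<Phi>\<^sub>a\<^sub>b = \<xi>\<^sub>a(a \ b)\<close>.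
\<close>

lemma xi_cocycle:
  assumes "a \<in> L" "b \<in> L" "c \<in> L" "w \<in> L"
  shows "xi_of R a (dv a b) (xi_of R b (dv b c) w) = xi_of R a (dv a c) w"
proof -
  have "\<forall>l\<in>L. \<forall>u\<in>L. \<forall>v\<in>L. \<forall>w\<in>L.
      xi_of R l u (xi_of R (m l u) v w) = xi_of R l (dv l (m (m l u) v)) w"
    using D1_object unfolding D1_object_def by (elim conjE)
  from this[rule_format, of a "dv a b" "dv b c" w] show ?thesis
    using assms by (simp add: dv_simps)
qed

lemma xi_refl:
  assumes "a \<in> L" "w \<in> L"
  shows "xi_of R a (dv a a) w = w"
  using D1_object assms unfolding D1_object_def by (elim conjE) simp

text \<open>The inner factor is \<open>\<Phi>\<^sub>a\<^sub>q(v)\<close>, where \<open>q\<close> is the base point.\<close>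

definition gauge_mult :: "'a \<Rightarrow> 'a \<Rightarrow> 'a \<Rightarrow> 'a" where
  "gauge_mult q a v = m a (xi_of R a (dv a q) v)"

text \<open>Division is explicit because \<open>\<Phi>\<^sub>q\<^sub>a\<close> is a two-sided inverse of \<open>\<Phi>\<^sub>a\<^sub>q\<close>.\<close>

lemma gauge_mult_eq_iff:
  assumes "q \<in> L" "a \<in> L" "v \<in> L" "w \<in> L"
  shows "gauge_mult q a v = w \<longleftrightarrow> v = xi_of R q (dv q a) (dv a w)"
proof
  assume "gauge_mult q a v = w"
  moreover have "xi_of R a (dv a q) v \<in> L" using assms by (simp add: xi_closed dv_simps)
  ultimately have "dv a w = xi_of R a (dv a q) v"
    using assms dv_simps(3) unfolding gauge_mult_def by blast
  then show "v = xi_of R q (dv q a) (dv a w)"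
    using xi_cocycle[of q a q v] xi_refl[of q v] assms by metis
next
  assume "v = xi_of R q (dv q a) (dv a w)"
  then show "gauge_mult q a v = w"
    using assms by (simp add: gauge_mult_def xi_cocycle xi_refl dv_simps)
qed

lemma left_quasigroup_gauge:
  assumes q: "q \<in> L"
  shows "left_quasigroup L (gauge_mult q)"
proof -
  have "\<exists>!v. v \<in> L \<and> gauge_mult q a v = w" if "a \<in> L" "w \<in> L" for a w
  proof (rule ex1I[of _ "xi_of R q (dv q a) (dv a w)"])
    show "xi_of R q (dv q a) (dv a w) \<in> L \<and> gauge_mult q a (xi_of R q (dv q a) (dv a w)) = w"
      using q that by (simp add: gauge_mult_eq_iff xi_closed dv_simps)
  qed (use q that gauge_mult_eq_iff in blast)
  moreover have "gauge_mult q a v \<in> L" if "a \<in> L" "v \<in> L" for a v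
    using q that by (simp add: gauge_mult_def m_closed xi_closed dv_simps)
  ultimately show ?thesis using q unfolding left_quasigroup_def by blast
qed

text \<open>
  The division of the new product is \<open>b \ c = \<Phi>\<^sub>q\<^sub>b(v)\<close> with \<open>v\<close> the old quotient, so that
  \<open>a * (b \ c) = a \<Phi>\<^sub>a\<^sub>q(\<Phi>\<^sub>q\<^sub>b(v)) = a \<Phi>\<^sub>a\<^sub>b(v)\<close> and the base point \<open>q\<close> cancels.
\<close>

lemma midpoint_gauge:
  assumes "q \<in> L" "a \<in> L" "b \<in> L" "c \<in> L"
  shows "\<mu> a b c = gauge_mult q a (ldiv L (gauge_mult q) b c)"
proof -
  have "ldiv L (gauge_mult q) b c = xi_of R q (dv q b) (dv b c)"
    using assms
    by (intro ldiv_eqI[OF left_quasigroup_gauge]) (simp_all add: gauge_mult_eq_iff xi_closed dv_simps)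
  then show ?thesis
    using assms by (simp add: midpoint_def gauge_mult_def xi_cocycle dv_simps)
qed

lemma R_eq_R_map:
  assumes "a \<in> L" "p \<in> L \<times> L"
  shows "R a p = R_map L m \<mu> id a p"
proof -
  obtain b c where "b \<in> L" "c \<in> L" "p = (dv a b, dv b c)"
    using path_of_labels[OF quasigroup assms] .
  then show ?thesis
    using assms R_path R_map_path[OF quasigroup] midpoint_closed by simp
qed

end

section \<open>The vertex-IRF correspondence\<close>

theorem proposition8p3:
  fixes L :: "'a set"
    and m :: "'a \<Rightarrow> 'a \<Rightarrow> 'a"
    and R :: "'a \<Rightarrow> 'a \<times> 'a \<Rightarrow> 'a \<times> 'a"
  assumes "D1_object L m R"
  shows "\<exists>(L2 :: 'a set) m2 (M :: 'a set) \<mu> \<pi>1 \<pi>2 R2.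
    left_quasigroup L2 m2 \<and>
    ternary_system M \<mu> \<and>
    (\<forall>a\<in>M. \<forall>b\<in>M. \<forall>c\<in>M. \<forall>d\<in>M.
       \<mu> a (\<mu> a b c) (\<mu> (\<mu> a b c) c d) = \<mu> a b (\<mu> b c d)) \<and>
    (\<forall>a\<in>M. \<forall>b\<in>M. \<forall>c\<in>M. \<forall>d\<in>M.
       \<mu> (\<mu> a b c) c d = \<mu> (\<mu> a b (\<mu> b c d)) (\<mu> b c d) d) \<and>
    bij_betw \<pi>1 L M \<and>
    bij_betw \<pi>2 L2 M \<and>
    (\<forall>l\<in>L. \<forall>p \<in> L \<times> L. R l p = R_map L m \<mu> \<pi>1 l p) \<and>
    (\<forall>l2\<in>L2. \<forall>p \<in> L2 \<times> L2. R_map L2 m2 \<mu> \<pi>2 l2 p = R2 p) \<and>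
    (\<forall>l\<in>L. \<forall>p \<in> L \<times> L.
       R l p =
       (inv_into (L \<times> L) (J_map m L2 m2 \<pi>1 \<pi>2 l) \<circ> flip21 R2 \<circ>
        flip21 (J_map m L2 m2 \<pi>1 \<pi>2 l)) p)"
proof -
  interpret D1 L m R using assms by unfold_locales
  obtain q where q: "q \<in> L" using quasigroup unfolding left_quasigroup_def by blast
  let ?m2 = "gauge_mult q" and ?R2 = "R_map L (gauge_mult q) \<mu> id q"
  note m2 = left_quasigroup_gauge[OF q]
  have const: "R_map L ?m2 \<mu> id l p = ?R2 p" if "l \<in> L" "p \<in> L \<times> L" for l p
    using ternary_YB_imp_label_independent[of L ?m2 \<mu> l q p]
      m2 midpoint_gauge[OF q] midpoint_YB q that by blast
  have IRF: "R l p = (inv_into (L \<times> L) (J_map m L ?m2 id id l) \<circ> flip21 ?R2 \<circ>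
      flip21 (J_map m L ?m2 id id l)) p" if l: "l \<in> L" and p: "p \<in> L \<times> L" for l p
  proof -
    obtain b c where bc: "b \<in> L" "c \<in> L" "p = (dv l b, dv b c)"
      using path_of_labels[OF quasigroup l p] .
    \<comment> \<open>The intertwining relation holds for the map at the dynamical parameter \<open>l\<close>; by constancy it may be
      replaced by the one at \<open>q\<close>.\<close>
    have "prod.swap (flip21 (J_map m L ?m2 id id l) p) \<in> L \<times> L"
      using J_path[OF quasigroup m2 l] bc l by (simp add: flip21_def ldiv_in[OF m2])
    then have "flip21 ?R2 (flip21 (J_map m L ?m2 id id l) p)
        = flip21 (R_map L ?m2 \<mu> id l) (flip21 (J_map m L ?m2 id id l) p)"
      using const[OF l] by (simp add: flip21_def)
    then show ?thesis
      using R_eq_R_map[OF l p] J_map_intertwines[OF quasigroup m2 midpoint_closed l p] by simp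
  qed
  have ternary: "ternary_system L \<mu>"
    using q midpoint_closed unfolding ternary_system_def by blast
  show ?thesis
    by (intro exI[of _ L] exI[of _ ?m2] exI[of _ \<mu>] exI[of _ id] exI[of _ ?R2] conjI ballI)
      (rule m2 ternary midpoint_assoc midpoint_YB bij_betw_id R_eq_R_map const IRF; assumption)+
qed

end
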